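(* Let $E=(0,\infty)$, let $\psi(x):=x$ for $x\in(0,\infty)$, and let $T:\mathcal{M}_1^\psi\to(0,\infty)$ be the unique maximum likelihood functional for the family $\{{\rm Exp}_\theta:\theta\in(0,\infty)\}$ of all exponential distributions. Then the sequence of maximum likelihood estimators $(\widehat T_n)$, $\widehat T_n(\boldsymbol{x}):=T(\frac1n\sum_{i=1}^n\delta_{x_i})$ for $\boldsymbol{x}=(x_1,x_2,\ldots)\in(0,\infty)^{\mathbb{N}}$, is robust on the class $\mathcal{M}_\Theta:=\{{\rm Exp}_\theta:\theta\in(0,\infty)\}$.
   Context: ${\rm Exp}_\theta$ is the probability measure on $(0,\infty)$ with Lebesgue density $f_\theta(x)=e^{-x/\theta}/\theta$, $\theta>0$. $\mathcal{M}_1^\psi$ is the set of all Borel probability measures $\mu$ on $(0,\infty)$ with $\int x\,\mu(dx)<\infty$. A maximum likelihood functional on $\mathcal{M}_1^\psi$ is a map $T$ with $T(\mu)\in\arg\max_{\theta\in(0,\infty)}\int\log f_\theta\,d\mu$ for all $\mu\in\mathcal{M}_1^\psi$; the maximizer is unique for each $\mu$, namely $\int x\,\mu(dx)$. Robustness: for a Borel probability measure $\mu$ on $E$ let $\mathbb{P}^\mu:=\mu^{\otimes\mathbb{N}}$ on $E^{\mathbb{N}}$. The state space $\Sigma=(0,\infty)$ is equipped with a complete metric inducing its usual topology, and $\pi$ is the corresponding Prohorov metric on the Borel probability measures on $\Sigma$. The sequence $(\widehat T_n)$ is robust on a set $M$ of Borel probability measures on $E$ if for every $\mu\in M$ and $\varepsilon>0$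 there is an open neighborhood $U$ of $\mu$ for the relative weak topology on $M$ such that $\pi(\mathbb{P}^\mu\circ\widehat T_n^{-1},\mathbb{P}^\nu\circ\widehat T_n^{-1})\le\varepsilon$ for all $\nu\in U$ and all $n\in\mathbb{N}$. *)

theory Defs
  imports "HOL-Probability.Probability"
begin

text \<open>Measures, topologies and metrics live on a set (\<open>E\<close> or \<open>S\<close>) of an ambient
  topological type, which carries the subspace topology.\<close>

definition borel_on :: "'a::topological_space set \<Rightarrow> 'a measure" where
  "borel_on E = restrict_space borel E"

definition borel_probs :: "'a::topological_space set \<Rightarrow> 'a measure set" where
  "borel_probs E = {\<mu>. prob_space \<mu> \<and> sets \<mu> = sets (borel_on E)}"

text \<open>The coarsest topology on the Borel probability measures on \<open>E\<close> for which
  \<open>\<mu> \<mapsto> \<integral>f d\<mu>\<close> is continuous for every bounded continuous \<open>f\<close> on \<open>E\<close>.\<close>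

definition weak_topology :: "'a::topological_space set \<Rightarrow> 'a measure topology" where
  "weak_topology E = topology_generated_by
     {{\<mu> \<in> borel_probs E. (\<integral>x. f x \<partial>\<mu>) \<in> V} | (f :: 'a \<Rightarrow> real) V.
        continuous_on E f \<and> bounded (f ` E) \<and> open V}"

text \<open>The Prohorov metric on the Borel probability measures on \<open>S\<close> induced by a metric \<open>d\<close> on \<open>S\<close>;
  the union of balls is the open \<open>\<epsilon>\<close>-neighbourhood of \<open>A\<close>.\<close>

definition prohorov ::
  "'a::topological_space set \<Rightarrow> ('a \<Rightarrow> 'a \<Rightarrow> real) \<Rightarrow> 'a measure \<Rightarrow> 'a measure \<Rightarrow> real" where
  "prohorov S d \<mu> \<nu> = Inf {\<epsilon>. \<epsilon> > 0 \<and> (\<forall>A \<in> sets (borel_on S).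
     measure \<mu> A \<le> measure \<nu> (\<Union>a\<in>A. Metric_space.mball S d a \<epsilon>) + \<epsilon> \<and>
     measure \<nu> A \<le> measure \<mu> (\<Union>a\<in>A. Metric_space.mball S d a \<epsilon>) + \<epsilon>)}"

text \<open>The law of an \<open>S\<close>-valued function of an i.i.d. sequence with marginal \<open>\<mu>\<close>.\<close>

definition law ::
  "'b::topological_space set \<Rightarrow> 'a measure \<Rightarrow> ((nat \<Rightarrow> 'a) \<Rightarrow> 'b) \<Rightarrow> 'b measure" where
  "law S \<mu> X = distr (\<Pi>\<^sub>M i\<in>UNIV. \<mu>) (borel_on S) X"

text \<open>The estimators are indexed by the sample size \<open>n \<ge> 1\<close>; their values at \<open>n = 0\<close> are ignored.\<close>

definition robust_on ::
  "'a::topological_space set \<Rightarrow> 'b::topological_space set \<Rightarrow> ('b \<Rightarrow> 'b \<Rightarrow> real) \<Rightarrow>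
   (nat \<Rightarrow> (nat \<Rightarrow> 'a) \<Rightarrow> 'b) \<Rightarrow> 'a measure set \<Rightarrow> bool" where
  "robust_on E S d X M \<longleftrightarrow>
     (\<forall>\<mu>\<in>M. \<forall>\<epsilon>>0. \<exists>U. openin (subtopology (weak_topology E) M) U \<and> \<mu> \<in> U \<and>
        (\<forall>\<nu>\<in>U. \<forall>n\<ge>1. prohorov S d (law S \<mu> (X n)) (law S \<nu> (X n)) \<le> \<epsilon>))"

text \<open>Sequences are indexed from \<open>0\<close>, so the sample of size \<open>n\<close> is \<open>x 0, \<dots>, x (n - 1)\<close>.\<close>

definition empirical :: "'a::topological_space set \<Rightarrow> nat \<Rightarrow> (nat \<Rightarrow> 'a) \<Rightarrow> 'a measure" where
  "empirical E n x = measure_of E (sets (borel_on E))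
     (\<lambda>A. (\<Sum>i<n. emeasure (return (borel_on E) (x i)) A) / of_nat n)"

definition M1 :: "'a::topological_space set \<Rightarrow> ('a \<Rightarrow> real) \<Rightarrow> 'a measure set" where
  "M1 E \<psi> = {\<mu> \<in> borel_probs E. (\<integral>\<^sup>+x. ennreal (\<psi> x) \<partial>\<mu>) < \<infinity>}"

definition ml_functional ::
  "'a measure set \<Rightarrow> 'b set \<Rightarrow> ('b \<Rightarrow> 'a \<Rightarrow> real) \<Rightarrow> ('a measure \<Rightarrow> 'b) \<Rightarrow> bool" where
  "ml_functional M \<Theta> f T \<longleftrightarrow>
     (\<forall>\<mu>\<in>M. is_arg_max (\<lambda>\<theta>. \<integral>x. ln (f \<theta> x) \<partial>\<mu>) (\<lambda>\<theta>. \<theta> \<in> \<Theta>) (T \<mu>))"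

definition exp_pdf :: "real \<Rightarrow> real \<Rightarrow> real" where
  "exp_pdf \<theta> x = exp (- x / \<theta>) / \<theta>"

definition exp_dist :: "real \<Rightarrow> real measure" where
  "exp_dist \<theta> = density (restrict_space lborel {0<..}) (\<lambda>x. ennreal (exp_pdf \<theta> x))"

lemma space_borel_on [simp]: "space (borel_on E) = E"
  by (simp add: borel_on_def space_restrict_space)

lemma sets_empirical [simp]: "sets (empirical E n x) = sets (borel_on E)"
  using sets.sets_measure_of_eq[of "borel_on E"] by (simp add: empirical_def)

lemma emeasure_empirical:
  assumes "A \<in> sets (borel_on E)"
  shows "emeasure (empirical E n x) A = (\<Sum>i<n. emeasure (return (borel_on E) (x i)) A) / of_nat n"
proof -
  let ?m = "\<lambda>A. (\<Sum>i<n. emeasure (return (borel_on E) (x i)) A) / of_nat n"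
  have ca: "countably_additive (sets (borel_on E)) ?m"
  proof (rule countably_additiveI)
    fix A :: "nat \<Rightarrow> _" assume A: "range A \<subseteq> sets (borel_on E)" "disjoint_family A"
    have *: "(\<Sum>k. emeasure (return (borel_on E) (x i)) (A k)) =
             emeasure (return (borel_on E) (x i)) (\<Union>k. A k)" for i
      using A by (intro suminf_emeasure) auto
    show "(\<Sum>k. ?m (A k)) = ?m (\<Union>k. A k)"
      by (simp add: divide_ennreal_def suminf_sum[symmetric] * suminf_sum)
  qed
  show ?thesis
    unfolding empirical_def
  proof (rule emeasure_measure_of_sigma)
    show "sigma_algebra E (sets (borel_on E))"
      using sets.sigma_algebra_axioms[of "borel_on E"] by simp
    show "positive (sets (borel_on E)) ?m"
      by (simp add: positive_def)
  qed (use ca assms in auto)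
qed

lemma exp_pdf_eq: "x \<ge> 0 \<Longrightarrow> exp_pdf \<theta> x = exponential_density (1 / \<theta>) x"
  by (simp add: exp_pdf_def exponential_density_def)

lemma exp_dist_in_borel_probs:
  assumes "\<theta> > 0"
  shows "exp_dist \<theta> \<in> borel_probs {0<..}"
proof -
  have m: "(\<lambda>x. ennreal (exp_pdf \<theta> x)) \<in> borel_measurable lborel"
    unfolding exp_pdf_def by measurable
  have "emeasure (exp_dist \<theta>) (space (exp_dist \<theta>)) =
      (\<integral>\<^sup>+x. ennreal (exp_pdf \<theta> x) \<partial>restrict_space lborel {0<..})"
    unfolding exp_dist_def
    using m by (subst emeasure_density) (auto intro!: nn_integral_cong measurable_restrict_space1
      sets.top[of "restrict_space lborel {0<..}", simplified space_restrict_space, simplified])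
  also have "\<dots> = (\<integral>\<^sup>+x. ennreal (exp_pdf \<theta> x) * indicator {0<..} x \<partial>lborel)"
    by (subst nn_integral_restrict_space) auto
  also have "\<dots> = (\<integral>\<^sup>+x. ennreal (exponential_density (1 / \<theta>) x) \<partial>lborel)"
  proof (rule nn_integral_cong_AE)
    show "AE x in lborel. ennreal (exp_pdf \<theta> x) * indicator {0<..} x =
        ennreal (exponential_density (1 / \<theta>) x)"
      using AE_lborel_singleton[of 0]
      by eventually_elim (simp add: indicator_def exp_pdf_def exponential_density_def)
  qed
  also have "\<dots> = emeasure (density lborel (exponential_density (1 / \<theta>)))
      (space (density lborel (exponential_density (1 / \<theta>))))"
    by (simp add: emeasure_density)
  also have "\<dots> = 1"
    using assms by (intro prob_space.emeasure_space_1 prob_space_exponential_density) simp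
  finally have "prob_space (exp_dist \<theta>)"
    by (rule prob_spaceI)
  thus ?thesis
    by (simp add: borel_probs_def borel_on_def exp_dist_def sets_restrict_space)
qed

lemma mean_is_ml_functional_exp:
  "ml_functional (M1 {0<..} (\<lambda>x. x)) {0<..} exp_pdf (\<lambda>\<mu>. \<integral>x. x \<partial>\<mu>)"
  and ml_functional_exp_unique:
  "ml_functional (M1 {0<..} (\<lambda>x. x)) {0<..} exp_pdf T \<Longrightarrow> \<mu> \<in> M1 {0<..} (\<lambda>x. x) \<Longrightarrow>
     T \<mu> = (\<integral>x. x \<partial>\<mu>)"
proof -
  have *: "(\<integral>x. x \<partial>\<mu>) > 0 \<and> (\<forall>\<theta>>0. (\<integral>x. ln (exp_pdf \<theta> x) \<partial>\<mu>) = - (\<integral>x. x \<partial>\<mu>) / \<theta> - ln \<theta>)"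
    if \<mu>: "\<mu> \<in> M1 {0<..} (\<lambda>x. x)" for \<mu> :: "real measure"
  proof -
    from \<mu> interpret prob_space \<mu> by (simp add: M1_def borel_probs_def)
    have s: "sets \<mu> = sets (borel_on {0<..})" and fin: "(\<integral>\<^sup>+x. ennreal x \<partial>\<mu>) < \<infinity>"
      using \<mu> by (auto simp: M1_def borel_probs_def)
    have sp: "space \<mu> = {0<..}"
      using sets_eq_imp_space_eq[OF s] by simp
    have m: "(\<lambda>x::real. x) \<in> borel_measurable \<mu>"
      by (subst measurable_cong_sets[OF s refl])
         (simp add: borel_on_def measurable_restrict_space1)
    have i: "integrable \<mu> (\<lambda>x::real. x)"
      using m fin by (intro integrableI_nonneg) (auto simp: sp intro!: AE_I2)
    have "(\<integral>x. x \<partial>\<mu>) > 0"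
      using integral_less_AE_space[of "\<lambda>_. 0" "\<lambda>x. x"] i AE_I2[of \<mu> "\<lambda>x. 0 < x"]
        emeasure_space_1 by (simp add: sp)
    moreover have "(\<integral>x. ln (exp_pdf \<theta> x) \<partial>\<mu>) = - (\<integral>x. x \<partial>\<mu>) / \<theta> - ln \<theta>" if "\<theta> > 0" for \<theta>
    proof -
      have "(\<integral>x. ln (exp_pdf \<theta> x) \<partial>\<mu>) = (\<integral>x. - (x / \<theta>) - ln \<theta> \<partial>\<mu>)"
        using that by (intro Bochner_Integration.integral_cong) (auto simp: exp_pdf_def ln_div)
      also have "\<dots> = - ((\<integral>x. x \<partial>\<mu>) / \<theta>) - ln \<theta>"
        using i by (subst Bochner_Integration.integral_diff) (auto simp: prob_space)
      finally show ?thesis by simp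
    qed
    ultimately show ?thesis by blast
  qed
  have lt: "- m / \<theta> - ln \<theta> < - m / m - ln m" if "m > 0" "\<theta> > 0" "\<theta> \<noteq> m" for m \<theta> :: real
  proof -
    have "ln (m / \<theta>) < m / \<theta> - 1"
      using ln_le_minus_one[of "m / \<theta>"] ln_eq_minus_one[of "m / \<theta>"] that by fastforce
    thus ?thesis using that by (simp add: ln_div)
  qed
  have le: "- m / \<theta> - ln \<theta> \<le> - m / m - ln m" if "m > 0" "\<theta> > 0" for m \<theta> :: real
    using lt[OF that] by (cases "\<theta> = m") auto
  show "ml_functional (M1 {0<..} (\<lambda>x. x)) {0<..} exp_pdf (\<lambda>\<mu>. \<integral>x. x \<partial>\<mu>)"
    unfolding ml_functional_def is_arg_max_def
  proof (intro ballI conjI notI)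
    fix \<mu> assume "\<mu> \<in> M1 {0<..} (\<lambda>x::real. x)"
    note \<mu> = *[OF this]
    show "(\<integral>x. x \<partial>\<mu>) \<in> {0<..}" using \<mu> by simp
    assume "\<exists>\<theta>. \<theta> \<in> {0<..} \<and>
      (\<integral>x. ln (exp_pdf (\<integral>x. x \<partial>\<mu>) x) \<partial>\<mu>) < (\<integral>x. ln (exp_pdf \<theta> x) \<partial>\<mu>)"
    then obtain \<theta> where \<theta>: "\<theta> > 0"
      "(\<integral>x. ln (exp_pdf (\<integral>x. x \<partial>\<mu>) x) \<partial>\<mu>) < (\<integral>x. ln (exp_pdf \<theta> x) \<partial>\<mu>)"
      by auto
    thus False
      using le[of "\<integral>x. x \<partial>\<mu>" \<theta>] \<mu> by (metis linorder_not_less)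
  qed
  assume T: "ml_functional (M1 {0<..} (\<lambda>x. x)) {0<..} exp_pdf T" and \<mu>: "\<mu> \<in> M1 {0<..} (\<lambda>x. x)"
  show "T \<mu> = (\<integral>x. x \<partial>\<mu>)"
  proof (rule ccontr)
    assume ne: "T \<mu> \<noteq> (\<integral>x. x \<partial>\<mu>)"
    have pos: "T \<mu> > 0"
      using T \<mu> unfolding ml_functional_def is_arg_max_def by auto
    have "(\<integral>x. ln (exp_pdf (T \<mu>) x) \<partial>\<mu>) < (\<integral>x. ln (exp_pdf (\<integral>x. x \<partial>\<mu>) x) \<partial>\<mu>)"
      using lt[of "\<integral>x. x \<partial>\<mu>" "T \<mu>"] *[OF \<mu>] pos ne by metis
    thus False
      using T \<mu> *[OF \<mu>] unfolding ml_functional_def is_arg_max_def by (metis greaterThan_iff)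
  qed
qed

end

theory Submission
  imports Defs
begin

text \<open>Scaling by \<open>\<theta>\<close> maps \<open>exp_dist 1\<close> to \<open>exp_dist \<theta>\<close>, so the sample means \<open>\<theta> Y\<^sub>n\<close> under all
  parameters live on one probability space, where \<open>Y\<^sub>n\<close> is the sample mean of standard exponential
  variables. Markov's inequality confines \<open>Y\<^sub>n\<close> to a compact subset of \<open>(0, \<infinity>)\<close>, uniformly in \<open>n\<close>,
  up to a small probability. On that compact set \<open>d\<close> is uniformly controlled by the Euclidean
  distance, so \<open>\<theta> Y\<^sub>n\<close> and \<open>\<theta>' Y\<^sub>n\<close> are uniformly close when \<open>\<theta>'\<close> is close to \<open>\<theta>\<close>. Finally
  closeness of the parameters is a weakly open condition, since \<open>\<integral> exp (- x) = 1 / (1 + \<theta>)\<close>.\<close>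

section \<open>Couplings and metrics inducing the same topology\<close>

text \<open>Coupling bound: outside \<open>B\<close>, \<open>X \<omega> \<in> A\<close> forces
  \<open>Y \<omega>\<close> into the \<epsilon>-neighbourhood of \<open>A\<close>, and
  \<open>B\<close> costs at most \<epsilon>. Hence \<epsilon> lies in the set whose infimum is
  \<open>prohorov\<close>.\<close>

lemma prohorov_distr_le:
  assumes S: "Metric_space S d" "Metric_space.mtopology S d = top_of_set S"
    and P: "prob_space P" and X: "X \<in> measurable P (borel_on S)" and Y: "Y \<in> measurable P (borel_on S)"
    and B: "B \<in> sets P" "measure P B \<le> \<epsilon>" and \<epsilon>: "\<epsilon> > 0"
    and close: "\<And>\<omega>. \<omega> \<in> space P - B \<Longrightarrow> d (X \<omega>) (Y \<omega>) < \<epsilon>"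
  shows "prohorov S d (distr P (borel_on S) X) (distr P (borel_on S) Y) \<le> \<epsilon>"
proof -
  interpret Metric_space S d by (rule S)
  interpret prob_space P by (rule P)
  \<comment> \<open>The neighbourhood is a union of \<open>d\<close>-balls, hence relatively open in
    \<open>S\<close> and Borel, whatever \<open>A\<close> is.\<close>
  have nbhd: "(\<Union>a\<in>A. mball a \<epsilon>) \<in> sets (borel_on S)" for A
  proof -
    have "openin (top_of_set S) (\<Union>a\<in>A. mball a \<epsilon>)"
      using S(2) by (metis (mono_tags, lifting) imageE openin_Union openin_mball)
    then show ?thesis
      by (auto simp: openin_open borel_on_def sets_restrict_space)
  qed
  \<comment> \<open>\<open>X\<close> and \<open>Y\<close> are quantified afresh so that swapping
    them yields the second Prohorov inequality.\<close>
  have "measure (distr P (borel_on S) X) A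
      \<le> measure (distr P (borel_on S) Y) (\<Union>a\<in>A. mball a \<epsilon>) + \<epsilon>"
    if A: "A \<in> sets (borel_on S)" and X: "X \<in> measurable P (borel_on S)"
      and Y: "Y \<in> measurable P (borel_on S)"
      and close: "\<And>\<omega>. \<omega> \<in> space P - B \<Longrightarrow> d (X \<omega>) (Y \<omega>) < \<epsilon>" for A X Y
  proof -
    have sp: "X \<omega> \<in> S" "Y \<omega> \<in> S" if "\<omega> \<in> space P" for \<omega>
      using measurable_space[OF X that] measurable_space[OF Y that] by auto
    have Ymeas: "Y -` (\<Union>a\<in>A. mball a \<epsilon>) \<inter> space P \<in> events"
      by (rule measurable_sets[OF Y nbhd])
    have "prob (X -` A \<inter> space P) \<le> prob (Y -` (\<Union>a\<in>A. mball a \<epsilon>) \<inter> space P \<union> B)"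
    proof (rule finite_measure_mono)
      show "X -` A \<inter> space P \<subseteq> Y -` (\<Union>a\<in>A. mball a \<epsilon>) \<inter> space P \<union> B"
      proof
        fix \<omega> assume "\<omega> \<in> X -` A \<inter> space P"
        then show "\<omega> \<in> Y -` (\<Union>a\<in>A. mball a \<epsilon>) \<inter> space P \<union> B"
          using close[of \<omega>] sp[of \<omega>] by (cases "\<omega> \<in> B") auto
      qed
    qed (use Ymeas B in auto)
    also have "\<dots> \<le> prob (Y -` (\<Union>a\<in>A. mball a \<epsilon>) \<inter> space P) + \<epsilon>"
      using measure_Un_le[OF Ymeas B(1)] B(2) by linarith
    finally show ?thesis
      using A nbhd X Y by (simp add: measure_distr)
  qed
  from this[OF _ X Y close] this[OF _ Y X]
  show ?thesis
    unfolding prohorov_def using close \<epsilon>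
    by (intro cInf_lower bdd_belowI[of _ 0]) (auto simp: commute[of "Y _" "X _"])
qed

text \<open>A Lebesgue number argument: \<open>d\<close> and \<open>dist\<close> share only their
  topology, but \<open>d\<close>-balls of radius \<open>\<epsilon>/2\<close> form an open cover of
  \<open>C\<close>, and its Lebesgue number \<open>r\<close> puts \<open>x\<close> and
  \<open>y\<close> into one such ball. The point \<open>y\<close> may leave \<open>C\<close>, so in
  an application only one of the two points has to be confined to a compact set.\<close>

lemma Metric_space_uniform_on_compact:
  fixes S :: "'a::metric_space set"
  assumes "Metric_space S d" "Metric_space.mtopology S d = top_of_set S"
    and C: "compact C" "C \<subseteq> S" and \<epsilon>: "\<epsilon> > 0"
  shows "\<exists>r>0. \<forall>x\<in>C. \<forall>y\<in>S. dist x y < r \<longrightarrow> d x y < \<epsilon>"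
proof -
  interpret Metric_space S d by fact
  have "\<exists>G. open G \<and> mball z (\<epsilon>/2) = S \<inter> G" for z
    using openin_mball[of z "\<epsilon>/2"] assms(2) by (simp add: openin_open)
  then obtain G where G: "\<And>z. open (G z)" "\<And>z. mball z (\<epsilon>/2) = S \<inter> G z" by metis
  have "C \<subseteq> \<Union>(G ` C)"
  proof
    fix z assume "z \<in> C"
    then have "z \<in> mball z (\<epsilon>/2)" using C \<epsilon> by auto
    then show "z \<in> \<Union>(G ` C)" using G \<open>z \<in> C\<close> by auto
  qed
  then obtain r where r: "r > 0" "\<And>x. x \<in> C \<Longrightarrow> \<exists>U \<in> G ` C. ball x r \<subseteq> U"
    using Heine_Borel_lemma[OF C(1), of "G ` C"] G by (metis imageE)
  show ?thesis
  proof (intro exI[of _ r] conjI ballI impI r(1))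
    fix x y assume xy: "x \<in> C" "y \<in> S" "dist x y < r"
    then obtain z where z: "z \<in> C" "ball x r \<subseteq> G z" using r by blast
    then have "x \<in> mball z (\<epsilon>/2)" "y \<in> mball z (\<epsilon>/2)"
      unfolding G(2) using xy C r(1) by auto
    then show "d x y < \<epsilon>"
      using triangle[of x z y] commute[of x z] by auto
  qed
qed

section \<open>Infinite products of probability spaces\<close>

text \<open>Every coordinate has law \<mu>, so the average has expectation
  \<open>\<integral>x. h x \<partial>\<mu>\<close> for every \<open>n\<close>; Markov's inequality
  at level 1 then gives a bound uniform in \<open>n\<close>.\<close>

lemma prob_average_ge_1:
  fixes h :: "'a \<Rightarrow> real" and \<mu> :: "'a measure"
  assumes "prob_space \<mu>" and h: "integrable \<mu> h" "\<And>x. x \<in> space \<mu> \<Longrightarrow> h x \<ge> 0" and n: "n \<ge> 1"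
  shows "measure (\<Pi>\<^sub>M i\<in>(UNIV::nat set). \<mu>)
      {\<omega> \<in> space (\<Pi>\<^sub>M i\<in>(UNIV::nat set). \<mu>). 1 \<le> (\<Sum>i<n. h (\<omega> i)) / n} \<le> (\<integral>x. h x \<partial>\<mu>)"
    (is "measure ?P _ \<le> _")
proof -
  interpret product_prob_space "\<lambda>_. \<mu>" "UNIV::nat set"
    using assms(1) by (simp add: product_prob_space_def product_prob_space_axioms_def
      product_sigma_finite_def prob_space_imp_sigma_finite)
  have D: "distr ?P \<mu> (\<lambda>\<omega>. \<omega> i) = \<mu>" for i
    by (rule PiM_component) simp
  have comp: "integrable ?P (\<lambda>\<omega>. h (\<omega> i))" "(\<integral>\<omega>. h (\<omega> i) \<partial>?P) = (\<integral>x. h x \<partial>\<mu>)" for i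
  proof -
    show "integrable ?P (\<lambda>\<omega>. h (\<omega> i))"
      by (rule integrable_distr[of "\<lambda>\<omega>. \<omega> i" _ \<mu>]) (use h D in \<open>auto intro: measurable_component_singleton\<close>)
    show "(\<integral>\<omega>. h (\<omega> i) \<partial>?P) = (\<integral>x. h x \<partial>\<mu>)"
      using integral_distr[of "\<lambda>\<omega>. \<omega> i" ?P \<mu> h] h D[of i]
      by (simp add: measurable_component_singleton)
  qed
  have "measure ?P {\<omega> \<in> space ?P. 1 \<le> (\<Sum>i<n. h (\<omega> i)) / n} \<le> (\<integral>\<omega>. (\<Sum>i<n. h (\<omega> i)) / n \<partial>?P) / 1"
  proof (rule integral_Markov_inequality_measure[where A = "{}"])
    show "AE \<omega> in ?P. 0 \<le> (\<Sum>i<n. h (\<omega> i)) / n"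
      using h by (intro AE_I2) (auto intro!: divide_nonneg_nonneg sum_nonneg simp: space_PiM)
  qed (use comp in auto)
  also have "\<dots> = (\<integral>x. h x \<partial>\<mu>)"
    using comp n by simp
  finally show ?thesis .
qed

text \<open>Both sides agree on cylinders over finite index sets, which determine a finite measure
  on the product. The abstraction \<open>\<lambda>i\<in>I\<close> keeps the values
  extensional.\<close>

lemma PiM_distr:
  assumes \<mu>: "\<And>i. i \<in> I \<Longrightarrow> prob_space (\<mu> i)" and f: "\<And>i. i \<in> I \<Longrightarrow> f i \<in> measurable (\<mu> i) (N i)"
  shows "distr (PiM I \<mu>) (PiM I N) (\<lambda>\<omega>. \<lambda>i\<in>I. f i (\<omega> i)) = (\<Pi>\<^sub>M i\<in>I. distr (\<mu> i) (N i) (f i))"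
    (is "distr ?P ?N ?F = ?Q")
proof (rule measure_eqI_PiM_infinite[where I = I and M = N])
  have meas: "?F \<in> measurable ?P ?N"
    using f by (intro measurable_restrict) (auto intro: measurable_compose[OF measurable_component_singleton])
  show "finite_measure (distr ?P ?N ?F)"
    by (intro prob_space.finite_measure prob_space.prob_space_distr prob_space_PiM \<mu> meas)
  fix A J assume J: "finite J" "J \<subseteq> I" and A: "\<And>i. i \<in> J \<Longrightarrow> A i \<in> sets (N i)"
  have fA: "f i -` A i \<inter> space (\<mu> i) \<in> sets (\<mu> i)" if "i \<in> J" for i
    using that J A f by (intro measurable_sets[of _ _ "N i"]) auto
  have "distr ?P ?N ?F (prod_emb I N J (Pi\<^sub>E J A)) = ?P (?F -` prod_emb I N J (Pi\<^sub>E J A) \<inter> space ?P)"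
    using J A by (intro emeasure_distr meas sets_PiM_I) auto
  also have "?F -` prod_emb I N J (Pi\<^sub>E J A) \<inter> space ?P = prod_emb I \<mu> J (\<Pi>\<^sub>E i\<in>J. f i -` A i \<inter> space (\<mu> i))"
    using J measurable_space[OF f]
    by (auto simp: prod_emb_def space_PiM PiE_iff restrict_def extensional_def Pi_iff subset_eq)
  also have "?P \<dots> = (\<Prod>i\<in>J. \<mu> i (f i -` A i \<inter> space (\<mu> i)))"
    using J fA by (intro emeasure_PiM_emb \<mu>) auto
  also have "\<dots> = (\<Prod>i\<in>J. distr (\<mu> i) (N i) (f i) (A i))"
    using J A f by (intro prod.cong refl emeasure_distr[symmetric]) auto
  also have "\<dots> = ?Q (prod_emb I (\<lambda>i. distr (\<mu> i) (N i) (f i)) J (Pi\<^sub>E J A))"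
    using J A f \<mu> by (intro emeasure_PiM_emb[symmetric] prob_space.prob_space_distr) auto
  also have "prod_emb I (\<lambda>i. distr (\<mu> i) (N i) (f i)) J (Pi\<^sub>E J A) = prod_emb I N J (Pi\<^sub>E J A)"
    by (simp add: prod_emb_def)
  finally show "distr ?P ?N ?F (prod_emb I N J (Pi\<^sub>E J A)) = ?Q (prod_emb I N J (Pi\<^sub>E J A))" .
qed (auto intro!: sets_PiM_cong)

section \<open>Exponential distributions: scaling, mean, small values, Laplace transform\<close>

lemma sets_exp_dist: "sets (exp_dist \<theta>) = sets (borel_on {0<..})"
  by (simp add: borel_on_def exp_dist_def sets_restrict_space)

lemma space_exp_dist: "space (exp_dist \<theta>) = {0<..}"
  using sets_eq_imp_space_eq[OF sets_exp_dist] by simp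

lemma prob_space_exp_dist: "\<theta> > 0 \<Longrightarrow> prob_space (exp_dist \<theta>)"
  using exp_dist_in_borel_probs by (auto simp: borel_probs_def)

lemma measurable_exp_dist:
  assumes "f \<in> borel_measurable borel"
  shows "f \<in> borel_measurable (exp_dist \<theta>)"
  using assms by (subst measurable_cong_sets[OF sets_exp_dist refl])
    (simp add: borel_on_def measurable_restrict_space1)

lemma nn_integral_exp_dist:
  assumes [measurable]: "f \<in> borel_measurable borel"
  shows "(\<integral>\<^sup>+x. f x \<partial>exp_dist \<theta>) =
    (\<integral>\<^sup>+x. ennreal (exp_pdf \<theta> x) * f x * indicator {0<..} x \<partial>lborel)"
proof -
  have [measurable]: "exp_pdf \<theta> \<in> borel_measurable borel"
    unfolding exp_pdf_def by measurable
  show ?thesis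
    unfolding exp_dist_def
    by (subst nn_integral_density) (auto simp: nn_integral_restrict_space intro!: measurable_restrict_space1)
qed

text \<open>Change of variables: for \<open>x > 0\<close> the density satisfies
  \<open>exp_pdf 1 x = \<theta> * exp_pdf \<theta> (\<theta> * x)\<close>, and the factor \<theta>
  is the Jacobian of the scaling.\<close>

lemma distr_exp_dist_scale:
  assumes \<theta>: "\<theta> > 0"
  shows "distr (exp_dist 1) (borel_on {0<..}) ((*) \<theta>) = exp_dist \<theta>"
proof (rule measure_eqI)
  have sc: "(*) \<theta> \<in> measurable (exp_dist 1) (borel_on {0<..})"
    using \<theta> unfolding borel_on_def
    by (intro measurable_restrict_space2 measurable_exp_dist) (auto simp: space_exp_dist)
  fix A assume "A \<in> sets (distr (exp_dist 1) (borel_on {0<..}) ((*) \<theta>))"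
  then have A: "A \<in> sets (borel_on {0<..})" by simp
  then have Ab [measurable]: "A \<in> sets borel" and Ap: "A \<subseteq> {0<..}"
    by (auto simp: borel_on_def sets_restrict_space)
  have [measurable]: "exp_pdf t \<in> borel_measurable borel" for t
    unfolding exp_pdf_def by measurable
  have "emeasure (distr (exp_dist 1) (borel_on {0<..}) ((*) \<theta>)) A
      = (\<integral>\<^sup>+x. indicator A x \<partial>distr (exp_dist 1) (borel_on {0<..}) ((*) \<theta>))"
    using A by (subst nn_integral_indicator) auto
  also have "\<dots> = (\<integral>\<^sup>+x. indicator A (\<theta> * x) \<partial>exp_dist 1)"
    using sc A by (subst nn_integral_distr) auto
  also have "\<dots> = (\<integral>\<^sup>+x. ennreal (exp_pdf 1 x) * indicator A (\<theta> * x) * indicator {0<..} x \<partial>lborel)"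
    by (subst nn_integral_exp_dist) auto
  also have "\<dots> = (\<integral>\<^sup>+x. ennreal \<theta> * (ennreal (exp_pdf \<theta> (\<theta> * x)) * indicator A (\<theta> * x)
      * indicator {0<..} (\<theta> * x)) \<partial>lborel)"
    using \<theta> by (intro nn_integral_cong)
      (auto simp: exp_pdf_def indicator_def zero_less_mult_iff simp flip: ennreal_mult)
  also have "\<dots> = (\<integral>\<^sup>+x. ennreal (exp_pdf \<theta> x) * indicator A x * indicator {0<..} x \<partial>lborel)"
    using \<theta> by (subst nn_integral_cmult)
      (auto simp: nn_integral_real_affine[of "\<lambda>x. ennreal (exp_pdf \<theta> x) * indicator A x * indicator {0<..} x" \<theta> 0])
  also have "\<dots> = (\<integral>\<^sup>+x. indicator A x \<partial>exp_dist \<theta>)"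
    by (subst nn_integral_exp_dist) auto
  also have "\<dots> = emeasure (exp_dist \<theta>) A"
    using A by (subst nn_integral_indicator) (auto simp: sets_exp_dist)
  finally show "emeasure (distr (exp_dist 1) (borel_on {0<..}) ((*) \<theta>)) A = emeasure (exp_dist \<theta>) A" .
qed (simp add: sets_exp_dist)

lemma expectation_exp_dist_1:
  "integrable (exp_dist 1) (\<lambda>x. x)" "(\<integral>x. x \<partial>exp_dist 1) = 1"
proof -
  have "(\<integral>\<^sup>+x. ennreal x \<partial>exp_dist 1) =
      (\<integral>\<^sup>+x. ennreal (exp_pdf 1 x) * ennreal x * indicator {0<..} x \<partial>lborel)"
    by (rule nn_integral_exp_dist) simp
  \<comment> \<open>This is the Gamma integral with value \<open>1!\<close>. Adding the endpoint 0
    changes nothing, since the factor \<open>x\<close> vanishes there.\<close>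
  also have "\<dots> = (\<integral>\<^sup>+x. ennreal (x ^ 1 * exp (- x)) * indicator {0..} x \<partial>lborel)"
    by (intro nn_integral_cong)
      (auto simp: exp_pdf_def indicator_def mult.commute simp flip: ennreal_mult)
  also have "\<dots> = 1"
    by (subst nn_intergal_power_times_exp_Ici) simp
  finally have 1: "(\<integral>\<^sup>+x. ennreal x \<partial>exp_dist 1) = ennreal 1" by simp
  then have "has_bochner_integral (exp_dist 1) (\<lambda>x. x) 1"
    by (intro has_bochner_integral_nn_integral)
      (auto intro!: measurable_exp_dist AE_I2 simp: space_exp_dist)
  then show "integrable (exp_dist 1) (\<lambda>x. x)" "(\<integral>x. x \<partial>exp_dist 1) = 1"
    by (auto simp: has_bochner_integral_iff)
qed

text \<open>The density \<open>exp (- x)\<close> is at most 1 on the half-line, so the mass is at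
  most the Lebesgue length.\<close>

lemma measure_exp_dist_1_atMost:
  assumes "a \<ge> 0"
  shows "measure (exp_dist 1) {0<..a} \<le> a"
proof -
  have "emeasure (exp_dist 1) {0<..a} = (\<integral>\<^sup>+x. indicator {0<..a} x \<partial>exp_dist 1)"
    by (subst nn_integral_indicator) (auto simp: sets_exp_dist borel_on_def sets_restrict_space_iff)
  also have "\<dots> = (\<integral>\<^sup>+x. ennreal (exp_pdf 1 x) * indicator {0<..a} x * indicator {0<..} x \<partial>lborel)"
    by (rule nn_integral_exp_dist) simp
  also have "\<dots> \<le> (\<integral>\<^sup>+x. indicator {0<..a} x \<partial>lborel)"
    by (intro nn_integral_mono) (auto simp: exp_pdf_def indicator_def)
  also have "\<dots> = ennreal a" using assms by simp
  finally show ?thesis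
    using assms by (simp add: measure_def enn2real_leI)
qed

text \<open>Multiplying by \<open>exp (- x)\<close> raises the rate from \<open>1 / \<theta>\<close>
  to \<open>1 / \<theta> + 1\<close>. The product is therefore \<open>1 / (1 + \<theta>)\<close>
  times the exponential density with mean \<open>\<theta> / (1 + \<theta>)\<close>, whose total mass
  is 1.\<close>

lemma laplace_exp_dist:
  assumes \<theta>: "\<theta> > 0"
  shows "(\<integral>x. exp (- x) \<partial>exp_dist \<theta>) = 1 / (1 + \<theta>)"
proof -
  let ?\<eta> = "\<theta> / (1 + \<theta>)"
  have \<eta>: "?\<eta> > 0" using \<theta> by simp
  have pdf: "exp_pdf \<theta> x * exp (- x) = 1 / (1 + \<theta>) * exp_pdf ?\<eta> x" for x
  proof -
    have "exp (- x / \<theta>) * exp (- x) = exp (- x / ?\<eta>)"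
      using \<theta> by (subst exp_add[symmetric]) (simp add: field_simps)
    then have "exp_pdf \<theta> x * exp (- x) = exp (- x / ?\<eta>) / \<theta>"
      by (simp add: exp_pdf_def)
    then show ?thesis using \<theta> by (simp add: exp_pdf_def)
  qed
  have [measurable]: "exp_pdf ?\<eta> \<in> borel_measurable borel"
    unfolding exp_pdf_def by measurable
  have "(\<integral>\<^sup>+x. ennreal (exp (- x)) \<partial>exp_dist \<theta>) =
      (\<integral>\<^sup>+x. ennreal (exp_pdf \<theta> x) * ennreal (exp (- x)) * indicator {0<..} x \<partial>lborel)"
    by (rule nn_integral_exp_dist) simp
  also have "\<dots> = (\<integral>\<^sup>+x. ennreal (1 / (1 + \<theta>)) * (ennreal (exp_pdf ?\<eta> x) * 1 * indicator {0<..} x) \<partial>lborel)"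
  proof (rule nn_integral_cong)
    fix x :: real
    have "ennreal (exp_pdf \<theta> x) * ennreal (exp (- x)) = ennreal (1 / (1 + \<theta>)) * ennreal (exp_pdf ?\<eta> x)"
      using \<theta> \<eta> pdf[of x] by (simp add: exp_pdf_def flip: ennreal_mult)
    then show "ennreal (exp_pdf \<theta> x) * ennreal (exp (- x)) * indicator {0<..} x =
        ennreal (1 / (1 + \<theta>)) * (ennreal (exp_pdf ?\<eta> x) * 1 * indicator {0<..} x)"
      by (simp add: mult.assoc)
  qed
  also have "\<dots> = ennreal (1 / (1 + \<theta>)) * (\<integral>\<^sup>+x. 1 \<partial>exp_dist ?\<eta>)"
    using nn_integral_exp_dist[of "\<lambda>_. 1" ?\<eta>] by (subst nn_integral_cmult) auto
  also have "\<dots> = ennreal (1 / (1 + \<theta>))"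
    using prob_space.emeasure_space_1[OF prob_space_exp_dist[OF \<eta>]] by simp
  finally show ?thesis
    using \<theta> by (subst integral_eq_nn_integral) (auto intro!: measurable_exp_dist)
qed

section \<open>Empirical measures and their means\<close>

text \<open>Viewed as the image of the uniform law on the indices, with repeated points counted by
  multiplicity, the empirical measure has integrals that reduce to finite sums.\<close>

lemma empirical_eq_distr:
  assumes x: "\<And>i. x i \<in> E" and n: "n \<ge> 1"
  shows "empirical E n x = distr (uniform_count_measure {..<n}) (borel_on E) x"
proof (rule measure_eqI)
  fix A assume "A \<in> sets (empirical E n x)"
  then have A: "A \<in> sets (borel_on E)" by simp
  have meas: "x \<in> measurable (uniform_count_measure {..<n}) (borel_on E)"
    using x by (auto simp: measurable_def uniform_count_measure_def point_measure_def)
  have "(\<Sum>i<n. emeasure (return (borel_on E) (x i)) A) = (\<Sum>i<n. ennreal (indicator A (x i)))"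
    using A by (simp add: ennreal_indicator)
  also have "\<dots> = ennreal (\<Sum>i<n. indicator A (x i))"
    by (rule sum_ennreal) simp
  also have "(\<Sum>i<n. indicator A (x i)) = real (card (x -` A \<inter> {..<n}))"
    by (simp add: indicator_def sum.If_cases vimage_def Int_commute)
  finally show "emeasure (empirical E n x) A
      = emeasure (distr (uniform_count_measure {..<n}) (borel_on E) x) A"
    using A n meas by (simp add: emeasure_empirical emeasure_distr space_uniform_count_measure
      emeasure_uniform_count_measure divide_ennreal ennreal_of_nat_eq_real_of_nat)
qed simp

text \<open>Membership in \<open>M1\<close> makes uniqueness of the maximizer applicable to
  empirical measures; the second claim then turns the estimator into the sample mean.\<close>

lemma empirical_mean:
  assumes n: "n \<ge> 1" and x: "\<And>i. x i > 0"
  shows "empirical {0<..} n x \<in> M1 {0<..} (\<lambda>x. x)"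
    and "(\<integral>y. y \<partial>empirical {0<..} n x) = (\<Sum>i<n. x i) / n"
proof -
  let ?U = "uniform_count_measure {..<n}"
  have eq: "empirical {0<..} n x = distr ?U (borel_on {0<..}) x"
    using n x by (intro empirical_eq_distr) auto
  have meas: "x \<in> measurable ?U (borel_on {0<..})"
    using x by (auto simp: measurable_def uniform_count_measure_def point_measure_def)
  have id: "(\<lambda>y. y) \<in> borel_measurable (borel_on {0<..})"
    by (simp add: borel_on_def measurable_restrict_space1)
  have "prob_space (empirical {0<..} n x)"
    unfolding eq using n
    by (intro prob_space.prob_space_distr meas prob_space_uniform_count_measure) (auto simp: lessThan_empty_iff)
  moreover have "(\<integral>\<^sup>+y. ennreal y \<partial>empirical {0<..} n x) < \<infinity>"
  proof -
    have "(\<integral>\<^sup>+y. ennreal y \<partial>empirical {0<..} n x) = (\<integral>\<^sup>+i. ennreal (x i) \<partial>?U)"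
      unfolding eq using meas measurable_compose[OF id measurable_ennreal] by (subst nn_integral_distr) auto
    also have "\<dots> < \<infinity>"
      by (simp add: uniform_count_measure_def nn_integral_point_measure_finite ennreal_mult_less_top)
    finally show ?thesis .
  qed
  ultimately show "empirical {0<..} n x \<in> M1 {0<..} (\<lambda>x. x)"
    by (simp add: M1_def borel_probs_def)
  show "(\<integral>y. y \<partial>empirical {0<..} n x) = (\<Sum>i<n. x i) / n"
    unfolding eq integral_distr[OF meas id] by (simp add: integral_uniform_count_measure)
qed

section \<open>The law of the estimator and tightness of the sample mean\<close>

text \<open>Scaling each coordinate by \<theta> turns a standard exponential sample into one with
  parameter \<theta>, and the sample mean is homogeneous. All these laws thus come from one
  probability space, which provides the coupling.\<close>

lemma law_mle_exp_dist:
  assumes T: "ml_functional (M1 {0<..} (\<lambda>x. x)) {0<..} exp_pdf T" and \<theta>: "\<theta> > 0" and n: "n \<ge> 1"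
  shows "law {0<..} (exp_dist \<theta>) (\<lambda>x. T (empirical {0<..} n x)) =
    distr (\<Pi>\<^sub>M i\<in>UNIV. exp_dist 1) (borel_on {0<..}) (\<lambda>\<omega>. \<theta> * ((\<Sum>i<n. \<omega> i) / n))"
    and "(\<lambda>\<omega>. \<theta> * ((\<Sum>i<n. \<omega> i) / n)) \<in> measurable (\<Pi>\<^sub>M i\<in>UNIV. exp_dist 1) (borel_on {0<..})"
proof -
  let ?P = "\<lambda>t. \<Pi>\<^sub>M i\<in>(UNIV::nat set). exp_dist t" and ?B = "borel_on {0<..} :: real measure"
  let ?Y = "\<lambda>\<omega>. (\<Sum>i<n. \<omega> i) / real n"
  have pos: "\<omega> i > 0" if "\<omega> \<in> space (?P t)" for \<omega> i t
    using that by (auto simp: space_PiM space_exp_dist)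
  \<comment> \<open>Strict positivity comes from \<open>n \<ge> 1\<close>: the sum is
    nonempty.\<close>
  have Ypos: "?Y \<omega> > 0" if "\<omega> \<in> space (?P t)" for \<omega> t
    using pos[OF that] n by (intro divide_pos_pos sum_pos) (auto simp: lessThan_empty_iff)
  have Ymeas: "?Y \<in> borel_measurable (?P t)" for t
  proof (intro borel_measurable_divide borel_measurable_sum borel_measurable_const)
    fix i
    show "(\<lambda>\<omega>. \<omega> i) \<in> borel_measurable (?P t)"
      using measurable_compose[OF measurable_component_singleton[of i UNIV "\<lambda>_. exp_dist t"]
          measurable_exp_dist[of "\<lambda>x. x"]] by simp
  qed
  have meas: "(\<lambda>\<omega>. c * ?Y \<omega>) \<in> measurable (?P t) ?B" if "c > 0" for c t
    using Ymeas Ypos mult_pos_pos[OF that] unfolding borel_on_def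
    by (intro measurable_restrict_space2 borel_measurable_times) (auto simp del: times_divide_eq_right)
  show "(\<lambda>\<omega>. \<theta> * ?Y \<omega>) \<in> measurable (?P 1) ?B"
    using \<theta> by (rule meas)
  have scale: "(*) \<theta> \<in> measurable (exp_dist 1) ?B"
    using \<theta> unfolding borel_on_def
    by (intro measurable_restrict_space2 measurable_exp_dist) (auto simp: space_exp_dist)
  have "?P \<theta> = distr (?P 1) (\<Pi>\<^sub>M i\<in>UNIV. ?B) (\<lambda>\<omega>. \<lambda>i\<in>UNIV. \<theta> * \<omega> i)"
    using PiM_distr[of "UNIV :: nat set" "\<lambda>_. exp_dist 1" "\<lambda>_. (*) \<theta>" "\<lambda>_. ?B",
        OF prob_space_exp_dist[OF zero_less_one] scale]
    by (simp only: distr_exp_dist_scale[OF \<theta>])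
  \<comment> \<open>The target may be exchanged because \<open>exp_dist \<theta>\<close> and
    \<open>?B\<close> have the same measurable sets.\<close>
  moreover have "distr (?P 1) (\<Pi>\<^sub>M i\<in>UNIV. ?B) F = distr (?P 1) (?P \<theta>) F" for F
    by (intro distr_cong refl sets_PiM_cong) (auto simp: sets_exp_dist)
  ultimately have P: "?P \<theta> = distr (?P 1) (?P \<theta>) (\<lambda>\<omega>. \<lambda>i\<in>UNIV. \<theta> * \<omega> i)"
    by simp
  have F: "(\<lambda>\<omega>. \<lambda>i\<in>UNIV. \<theta> * \<omega> i) \<in> measurable (?P 1) (?P \<theta>)"
  proof (intro measurable_restrict)
    fix i :: nat
    show "(\<lambda>\<omega>. \<theta> * \<omega> i) \<in> measurable (?P 1) (exp_dist \<theta>)"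
      using measurable_compose[OF measurable_component_singleton[of i UNIV "\<lambda>_. exp_dist 1"] scale]
      by (simp add: measurable_cong_sets[OF refl sets_exp_dist])
  qed
  have "law {0<..} (exp_dist \<theta>) (\<lambda>x. T (empirical {0<..} n x)) = distr (?P \<theta>) ?B ?Y"
    unfolding law_def
  proof (rule distr_cong)
    fix x assume "x \<in> space (?P \<theta>)"
    then show "T (empirical {0<..} n x) = ?Y x"
      using ml_functional_exp_unique[OF T] empirical_mean[OF n] pos by metis
  qed auto
  also have "\<dots> = distr (distr (?P 1) (?P \<theta>) (\<lambda>\<omega>. \<lambda>i\<in>UNIV. \<theta> * \<omega> i)) ?B ?Y"
    using P by simp
  also have "\<dots> = distr (?P 1) ?B (\<lambda>\<omega>. \<theta> * ?Y \<omega>)"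
    using meas[of 1 \<theta>] F by (subst distr_distr) (auto simp: o_def sum_distrib_left)
  finally show "law {0<..} (exp_dist \<theta>) (\<lambda>x. T (empirical {0<..} n x)) =
      distr (?P 1) ?B (\<lambda>\<omega>. \<theta> * ?Y \<omega>)" .
qed

text \<open>If the sample mean is below \<open>\<eta>\<close>, then at least half of the sample lies below \<open>2 \<eta>\<close>. Hence both
  tails follow from Markov's inequality for averages, without using independence.\<close>

lemma sample_mean_tight:
  fixes \<eta> K :: real
  assumes n: "n \<ge> 1" and \<eta>: "\<eta> > 0" and K: "K > 0"
  obtains B where "B \<in> sets (\<Pi>\<^sub>M i\<in>(UNIV::nat set). exp_dist 1)"
    and "measure (\<Pi>\<^sub>M i\<in>(UNIV::nat set). exp_dist 1) B \<le> 4 * \<eta> + 1 / K"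
    and "\<And>\<omega>. \<omega> \<in> space (\<Pi>\<^sub>M i\<in>(UNIV::nat set). exp_dist 1) - B \<Longrightarrow> (\<Sum>i<n. \<omega> i) / n \<in> {\<eta>..K}"
proof -
  let ?P = "\<Pi>\<^sub>M i\<in>(UNIV::nat set). exp_dist 1"
  \<comment> \<open>An average of \<open>h\<close> below 1 means that fewer than half of the points
    lie in \<open>{0<..2*\<eta>}\<close>; an average of \<open>k\<close> below 1 means that the
    sample mean is below \<open>K\<close>.\<close>
  define h :: "real \<Rightarrow> real" where "h x = 2 * indicator {0<..2*\<eta>} x" for x
  define k where "k x = x / K" for x :: real
  define Bh where "Bh = {\<omega> \<in> space ?P. 1 \<le> (\<Sum>i<n. h (\<omega> i)) / n}"
  define Bk where "Bk = {\<omega> \<in> space ?P. 1 \<le> (\<Sum>i<n. k (\<omega> i)) / n}"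
  interpret prob_space "exp_dist 1" by (rule prob_space_exp_dist) simp
  have s: "{0<..2*\<eta>} \<in> sets (exp_dist 1)"
    by (auto simp: sets_exp_dist borel_on_def sets_restrict_space_iff)
  have "{0<..2*\<eta>} \<inter> {0<..} = {0<..2*\<eta>}" by auto
  \<comment> \<open>The weight 2 times the mass of \<open>{0<..2*\<eta>}\<close>, which is at most
    \<open>2*\<eta>\<close>.\<close>
  then have h: "integrable (exp_dist 1) h" "(\<integral>x. h x \<partial>exp_dist 1) \<le> 4 * \<eta>"
    using s \<eta> measure_exp_dist_1_atMost[of "2*\<eta>"] unfolding h_def
    by (auto simp: space_exp_dist emeasure_eq_measure)
  have k: "integrable (exp_dist 1) k" "(\<integral>x. k x \<partial>exp_dist 1) = 1 / K"
    using expectation_exp_dist_1 unfolding k_def by auto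
  have comp: "(\<lambda>\<omega>. f (\<omega> i)) \<in> borel_measurable ?P" if "f \<in> borel_measurable (exp_dist 1)"
    for f :: "real \<Rightarrow> real" and i
    using measurable_compose[OF measurable_component_singleton[of i UNIV "\<lambda>_. exp_dist 1"] that]
    by simp
  have sets: "{\<omega> \<in> space ?P. 1 \<le> (\<Sum>i<n. f (\<omega> i)) / n} \<in> sets ?P"
    if "integrable (exp_dist 1) f" for f :: "real \<Rightarrow> real"
  proof -
    have [measurable]: "(\<lambda>\<omega>. f (\<omega> i)) \<in> borel_measurable ?P" for i
      using that by (intro comp) auto
    show ?thesis by measurable
  qed
  show ?thesis
  proof (rule that[of "Bh \<union> Bk"])
    have Bs: "Bh \<in> sets ?P" "Bk \<in> sets ?P"
      unfolding Bh_def Bk_def using h k by (auto intro!: sets)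
    then show "Bh \<union> Bk \<in> sets ?P" by auto
    have "measure ?P Bh \<le> 4 * \<eta>" "measure ?P Bk \<le> 1 / K"
      unfolding Bh_def Bk_def
      using prob_average_ge_1[OF prob_space_axioms h(1) _ n] h(2)
        prob_average_ge_1[OF prob_space_axioms k(1) _ n] k(2) K
      by (auto simp: h_def k_def space_exp_dist intro: order_trans)
    then show "measure ?P (Bh \<union> Bk) \<le> 4 * \<eta> + 1 / K"
      using measure_Un_le[OF Bs] by linarith
    fix \<omega> assume \<omega>: "\<omega> \<in> space ?P - (Bh \<union> Bk)"
    let ?Y = "(\<Sum>i<n. \<omega> i) / n"
    have "\<omega> i > 0" for i
      using \<omega> by (auto simp: space_PiM space_exp_dist)
    \<comment> \<open>An affine minorant replaces counting: \<open>h\<close> is 2 up to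
      \<open>2*\<eta>\<close>, and beyond that point \<open>2 - x / \<eta>\<close> is negative.
      Averaging it bounds the sample mean from below.\<close>
    then have "h (\<omega> i) \<ge> 2 - \<omega> i / \<eta>" for i
      using \<eta> by (auto simp: h_def indicator_def field_simps not_le intro: less_imp_le)
    then have "(\<Sum>i<n. h (\<omega> i)) / n \<ge> (\<Sum>i<n. 2 - \<omega> i / \<eta>) / n"
      by (intro divide_right_mono sum_mono) auto
    also have "(\<Sum>i<n. 2 - \<omega> i / \<eta>) / n = 2 - ?Y / \<eta>"
      using n by (simp add: sum_subtractf diff_divide_distrib flip: sum_divide_distrib)
    finally have "2 - ?Y / \<eta> < 1"
      using \<omega> by (auto simp: Bh_def)
    then have "1 < ?Y / \<eta>" by linarith
    then have "\<eta> < ?Y" using \<eta> by (metis less_divide_eq_1_pos)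
    moreover have "?Y < K"
    proof -
      have "?Y / K < 1"
        using \<omega> by (auto simp: Bk_def k_def not_le mult.commute simp flip: sum_divide_distrib)
      then show ?thesis using K by (metis divide_less_eq_1_pos)
    qed
    ultimately show "?Y \<in> {\<eta>..K}" by simp
  qed
qed

section \<open>Weak neighbourhoods and robustness\<close>

text \<open>The function \<open>exp (- x)\<close> is bounded and continuous on the half-line, so its
  integral is weakly continuous; on the exponential laws this integral is
  \<open>1 / (1 + \<theta>)\<close>, which determines \<theta>. The identity is unbounded there and
  hence not a test function.\<close>

lemma exp_dist_weak_nbhd:
  fixes \<theta>\<^sub>0 \<delta> :: real
  assumes \<theta>\<^sub>0: "\<theta>\<^sub>0 > 0" and \<delta>: "\<delta> > 0"
  shows "\<exists>U. openin (subtopology (weak_topology {0<..}) {exp_dist \<theta> | \<theta>. \<theta> \<in> {0<..}}) U \<and>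
    exp_dist \<theta>\<^sub>0 \<in> U \<and> (\<forall>\<nu>\<in>U. \<exists>\<theta>>0. \<nu> = exp_dist \<theta> \<and> \<bar>\<theta> - \<theta>\<^sub>0\<bar> < \<delta>)"
proof -
  let ?M = "{exp_dist \<theta> | \<theta>. \<theta> \<in> {0<..}}"
  \<comment> \<open>The map \<open>v \<mapsto> inverse v - 1\<close> inverts
    \<open>\<theta> \<mapsto> 1 / (1 + \<theta>)\<close>; restricting to \<open>{0<..}\<close> keeps
    it continuous.\<close>
  define V :: "real set" where "V = {0<..} \<inter> (\<lambda>v. inverse v - 1) -` ball \<theta>\<^sub>0 \<delta>"
  define W where "W = {\<mu> \<in> borel_probs {0<..}. (\<integral>x. exp (- x) \<partial>\<mu>) \<in> V}"
  have "open V"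
    unfolding V_def by (rule continuous_open_preimage) (auto intro!: continuous_intros)
  moreover have "continuous_on {0<..} (\<lambda>x::real. exp (- x))" "bounded ((\<lambda>x::real. exp (- x)) ` {0<..})"
    by (auto intro!: continuous_intros boundedI[of _ 1])
  ultimately have W: "openin (weak_topology {0<..}) W"
    unfolding weak_topology_def W_def by (intro topology_generated_by_Basis) blast
  have iff: "exp_dist \<theta> \<in> W \<longleftrightarrow> \<bar>\<theta> - \<theta>\<^sub>0\<bar> < \<delta>" if "\<theta> > 0" for \<theta>
    using that exp_dist_in_borel_probs[OF that]
    by (auto simp: W_def V_def laplace_exp_dist dist_real_def abs_minus_commute)
  show ?thesis
  proof (intro exI[of _ "W \<inter> ?M"] conjI ballI)
    show "openin (subtopology (weak_topology {0<..}) ?M) (W \<inter> ?M)"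
      using W by (auto simp: openin_subtopology)
    show "exp_dist \<theta>\<^sub>0 \<in> W \<inter> ?M" using iff[OF \<theta>\<^sub>0] \<theta>\<^sub>0 \<delta> by auto
    show "\<exists>\<theta>>0. \<nu> = exp_dist \<theta> \<and> \<bar>\<theta> - \<theta>\<^sub>0\<bar> < \<delta>" if "\<nu> \<in> W \<inter> ?M" for \<nu>
      using that iff by auto
  qed
qed

theorem corollary4p6:
  fixes T :: "real measure \<Rightarrow> real"
    and d :: "real \<Rightarrow> real \<Rightarrow> real"
  assumes "Metric_space {0<..} d"
    and "Metric_space.mcomplete {0<..} d"
    and "Metric_space.mtopology {0<..} d = top_of_set {0<..}"
    and "ml_functional (M1 {0<..} (\<lambda>x. x)) {0<..} exp_pdf T"
  shows "robust_on {0<..} {0<..} d (\<lambda>n x. T (empirical {0<..} n x)) {exp_dist \<theta> | \<theta>. \<theta> \<in> {0<..}}"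
proof -
  let ?P = "\<Pi>\<^sub>M i\<in>(UNIV::nat set). exp_dist 1"
  have "\<exists>U. openin (subtopology (weak_topology {0<..}) {exp_dist \<theta> | \<theta>. \<theta> \<in> {0<..}}) U \<and>
      exp_dist \<theta>\<^sub>0 \<in> U \<and> (\<forall>\<nu>\<in>U. \<forall>n\<ge>1. prohorov {0<..} d
        (law {0<..} (exp_dist \<theta>\<^sub>0) (\<lambda>x. T (empirical {0<..} n x)))
        (law {0<..} \<nu> (\<lambda>x. T (empirical {0<..} n x))) \<le> \<epsilon>)"
    if \<theta>\<^sub>0: "\<theta>\<^sub>0 > 0" and \<epsilon>: "\<epsilon> > 0" for \<theta>\<^sub>0 \<epsilon> :: real
  proof -
    \<comment> \<open>These values make
      \<open>4 * \<eta> + 1 / K = \<epsilon> / 2 + \<epsilon> / 2\<close>, the probability allowed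
      for the exceptional set.\<close>
    define \<eta> where "\<eta> = \<epsilon> / 8"
    define K where "K = 2 / \<epsilon>"
    have \<eta>: "\<eta> > 0" and K: "K > 0" using \<epsilon> by (auto simp: \<eta>_def K_def)
    have "{\<theta>\<^sub>0 * \<eta>..\<theta>\<^sub>0 * K} \<subseteq> {0<..}"
    proof
      fix y assume "y \<in> {\<theta>\<^sub>0 * \<eta>..\<theta>\<^sub>0 * K}"
      then show "y \<in> {0<..}"
        using mult_pos_pos[OF \<theta>\<^sub>0 \<eta>] by auto
    qed
    \<comment> \<open>The interval contains \<open>\<theta>\<^sub>0 * Y\<close> whenever
      \<open>Y\<close> lies in \<open>{\<eta>..K}\<close>.\<close>
    then have "\<exists>r>0. \<forall>x\<in>{\<theta>\<^sub>0 * \<eta>..\<theta>\<^sub>0 * K}. \<forall>y\<in>{0<..}. dist x y < r \<longrightarrow> d x y < \<epsilon>"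
      by (rule Metric_space_uniform_on_compact[OF assms(1,3) compact_Icc _ \<epsilon>])
    then obtain r where r: "r > 0"
      "\<forall>x\<in>{\<theta>\<^sub>0 * \<eta>..\<theta>\<^sub>0 * K}. \<forall>y\<in>{0<..}. dist x y < r \<longrightarrow> d x y < \<epsilon>" by blast
    \<comment> \<open>For \<open>Y \<le> K\<close>, a parameter error below \<open>r / K\<close>
      moves \<open>\<theta>\<^sub>0 * Y\<close> by less than \<open>r\<close>. Neither
      \<open>r\<close> nor \<open>K\<close> depends on \<open>n\<close>, so one \<open>U\<close>
      serves all sample sizes.\<close>
    have "r / K > 0" using r(1) K by simp
    from exp_dist_weak_nbhd[OF \<theta>\<^sub>0 this] obtain U where
      U: "openin (subtopology (weak_topology {0<..}) {exp_dist \<theta> | \<theta>. \<theta> \<in> {0<..}}) U"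
        "exp_dist \<theta>\<^sub>0 \<in> U" "\<forall>\<nu>\<in>U. \<exists>\<theta>>0. \<nu> = exp_dist \<theta> \<and> \<bar>\<theta> - \<theta>\<^sub>0\<bar> < r / K"
      by blast
    have "prohorov {0<..} d (law {0<..} (exp_dist \<theta>\<^sub>0) (\<lambda>x. T (empirical {0<..} n x)))
        (law {0<..} \<nu> (\<lambda>x. T (empirical {0<..} n x))) \<le> \<epsilon>" if \<nu>: "\<nu> \<in> U" and n: "n \<ge> 1" for \<nu> n
    proof -
      obtain \<theta> where \<theta>: "\<theta> > 0" "\<nu> = exp_dist \<theta>" "\<bar>\<theta> - \<theta>\<^sub>0\<bar> < r / K"
        using U(3) \<nu> by blast
      \<comment> \<open>The exceptional set varies with \<open>n\<close>, but its probability bound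
        and the interval \<open>{\<eta>..K}\<close> do not.\<close>
      obtain B where B: "B \<in> sets ?P" "measure ?P B \<le> 4 * \<eta> + 1 / K"
        "\<And>\<omega>. \<omega> \<in> space ?P - B \<Longrightarrow> (\<Sum>i<n. \<omega> i) / n \<in> {\<eta>..K}"
        using sample_mean_tight[OF n \<eta> K] by blast
      show ?thesis
        unfolding \<theta>(2) law_mle_exp_dist(1)[OF assms(4) \<theta>\<^sub>0 n] law_mle_exp_dist(1)[OF assms(4) \<theta>(1) n]
      proof (rule prohorov_distr_le[OF assms(1,3) _ law_mle_exp_dist(2)[OF assms(4) \<theta>\<^sub>0 n]
            law_mle_exp_dist(2)[OF assms(4) \<theta>(1) n] B(1) _ \<epsilon>])
        show "prob_space ?P" by (intro prob_space_PiM prob_space_exp_dist) simp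
        show "measure ?P B \<le> \<epsilon>" using B(2) by (simp add: \<eta>_def K_def)
        fix \<omega> assume \<omega>: "\<omega> \<in> space ?P - B"
        define Y where "Y = (\<Sum>i<n. \<omega> i) / real n"
        have Y: "\<eta> \<le> Y" "Y \<le> K" using B(3)[OF \<omega>] by (auto simp: Y_def)
        have "dist (\<theta>\<^sub>0 * Y) (\<theta> * Y) = \<bar>\<theta> - \<theta>\<^sub>0\<bar> * Y"
          using Y \<eta> by (simp add: dist_real_def abs_minus_commute abs_mult flip: left_diff_distrib)
        also have "\<dots> \<le> \<bar>\<theta> - \<theta>\<^sub>0\<bar> * K" using Y by (intro mult_left_mono) auto
        also have "\<dots> < r" using \<theta>(3) K by (simp add: less_divide_eq)
        finally have "d (\<theta>\<^sub>0 * Y) (\<theta> * Y) < \<epsilon>"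
          using Y \<theta>(1) \<theta>\<^sub>0 \<eta> by (intro r(2)[rule_format]) auto
        then show "d (\<theta>\<^sub>0 * ((\<Sum>i<n. \<omega> i) / n)) (\<theta> * ((\<Sum>i<n. \<omega> i) / n)) < \<epsilon>"
          by (simp add: Y_def)
      qed
    qed
    with U(1,2) show ?thesis by blast
  qed
  then show ?thesis
    unfolding robust_on_def by auto
qed

end
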